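(* For every integer $n \geq 1$, $\sigma(K_{1,n} \boxtimes K_{1,n}) \geq n + 1$, where $K_{1,n}$ is the star with $n$ leaves.
   Context: Surrounding Cops and Robbers on a finite simple graph $G$ with $k \geq 1$ cops and one robber: the cops first choose starting vertices (several cops may share a vertex), then the robber chooses a starting vertex not occupied by a cop, and thereafter the cops and the robber alternate moves, the cops moving first. In a move, each player may move to an adjacent vertex or stay put; the robber may never move to, or remain on, a vertex occupied by a cop, so if a cop moves onto the robber's vertex the robber is compelled to move to a neighbouring vertex not occupied by a cop. The cops win if at any time every neighbour of the robber's vertex is occupied by a cop; the robber wins if he avoids this forever. Play is with perfect information. The surrounding cop number $\sigma(G)$ is the least number of cops for which the cops have a winning strategy. The strong product $G \boxtimes H$ has vertex set $V(G)\times V(H)$, with distinct $(g,h)$ and $(g',h')$ adjacent iff ($g=g'$ or $gg'\in E(G)$) and ($h=h'$ or $hh'\in E(H)$). *)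

theory Defs
  imports "Graph_Theory.Kuratowski"
begin

text \<open>
  A finite simple graph is a \<^locale>\<open>pair_graph\<close>: a finite, loop-free, symmetric set of arcs,
  each edge being represented by its two orientations.
\<close>

definition strong_product ::
  "'a pair_pre_digraph \<Rightarrow> 'b pair_pre_digraph \<Rightarrow> ('a \<times> 'b) pair_pre_digraph"
  (infixl \<open>\<boxtimes>\<close> 70) where
  "G \<boxtimes> H = \<lparr> pverts = pverts G \<times> pverts H,
     parcs = {((g, h), (g', h')) | g h g' h'.
       g \<in> pverts G \<and> g' \<in> pverts G \<and> h \<in> pverts H \<and> h' \<in> pverts H \<and>
       (g, h) \<noteq> (g', h') \<and>
       (g = g' \<or> (g, g') \<in> parcs G) \<and> (h = h' \<or> (h, h') \<in> parcs H)} \<rparr>"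

text \<open>The cops are distinguishable: entry \<open>i\<close> of a placement is the vertex of cop \<open>i\<close>.\<close>

type_synonym 'a placement = "'a list"

definition cop_placement :: "'a pair_pre_digraph \<Rightarrow> nat \<Rightarrow> 'a placement \<Rightarrow> bool" where
  "cop_placement G k c \<longleftrightarrow> length c = k \<and> set c \<subseteq> pverts G"

definition may_step :: "'a pair_pre_digraph \<Rightarrow> 'a \<Rightarrow> 'a \<Rightarrow> bool" where
  "may_step G u v \<longleftrightarrow> v = u \<or> (u, v) \<in> parcs G"

definition cop_move :: "'a pair_pre_digraph \<Rightarrow> 'a placement \<Rightarrow> 'a placement \<Rightarrow> bool" where
  "cop_move G c c' \<longleftrightarrow> list_all2 (may_step G) c c'"

definition robber_move :: "'a pair_pre_digraph \<Rightarrow> 'a placement \<Rightarrow> 'a \<Rightarrow> 'a \<Rightarrow> bool" where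
  "robber_move G c r r' \<longleftrightarrow> may_step G r r' \<and> r' \<notin> set c"

definition surrounded :: "'a pair_pre_digraph \<Rightarrow> 'a placement \<Rightarrow> 'a \<Rightarrow> bool" where
  "surrounded G c r \<longleftrightarrow> (\<forall>v. (r, v) \<in> parcs G \<longrightarrow> v \<in> set c)"

text \<open>
  A strategy of the cops consists of an initial placement \<open>c\<^sub>0\<close> and a function \<open>f\<close> that maps the
  history, i.e. the list of all positions reached so far with the cops to move, to their next
  placement.
\<close>

definition cop_strategy ::
  "'a pair_pre_digraph \<Rightarrow> nat \<Rightarrow> 'a placement \<Rightarrow> (('a placement \<times> 'a) list \<Rightarrow> 'a placement) \<Rightarrow> bool"
  where
  "cop_strategy G k c\<^sub>0 f \<longleftrightarrow> cop_placement G k c\<^sub>0 \<and>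
     (\<forall>h c r. cop_placement G k c \<and> r \<in> pverts G \<longrightarrow> cop_move G c (f (h @ [(c, r)])))"

text \<open>
  Infinite plays against a strategy: \<open>c t\<close> and \<open>r t\<close> are the positions of the cops and the robber
  after \<open>t\<close> rounds, and \<open>(c (Suc t), r t)\<close> is the position between the two moves of a round.
  As long as he is not surrounded the robber has a legal move, so only plays that the cops have
  won already cannot be continued. The robber also loses if no vertex is left for him to start on.
\<close>

definition play_against ::
  "'a pair_pre_digraph \<Rightarrow> 'a placement \<Rightarrow> (('a placement \<times> 'a) list \<Rightarrow> 'a placement) \<Rightarrow>
   (nat \<Rightarrow> 'a placement) \<Rightarrow> (nat \<Rightarrow> 'a) \<Rightarrow> bool" where
  "play_against G c\<^sub>0 f c r \<longleftrightarrow>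
     c 0 = c\<^sub>0 \<and> r 0 \<in> pverts G \<and> r 0 \<notin> set c\<^sub>0 \<and>
     (\<forall>t. c (Suc t) = f (map (\<lambda>i. (c i, r i)) [0..<Suc t]) \<and>
          robber_move G (c (Suc t)) (r t) (r (Suc t)))"

definition winning_cop_strategy ::
  "'a pair_pre_digraph \<Rightarrow> nat \<Rightarrow> 'a placement \<Rightarrow> (('a placement \<times> 'a) list \<Rightarrow> 'a placement) \<Rightarrow> bool"
  where
  "winning_cop_strategy G k c\<^sub>0 f \<longleftrightarrow> cop_strategy G k c\<^sub>0 f \<and>
     (\<forall>c r. play_against G c\<^sub>0 f c r \<longrightarrow>
        (\<exists>t. surrounded G (c t) (r t) \<or> surrounded G (c (Suc t)) (r t)))"

definition cops_win :: "'a pair_pre_digraph \<Rightarrow> nat \<Rightarrow> bool" where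
  "cops_win G k \<longleftrightarrow> (\<exists>c\<^sub>0 f. winning_cop_strategy G k c\<^sub>0 f)"

definition surrounding_cop_number :: "'a pair_pre_digraph \<Rightarrow> nat" (\<open>\<sigma>\<close>) where
  "\<sigma> G = (LEAST k. k \<ge> 1 \<and> cops_win G k)"

text \<open>The minimum defining \<open>\<sigma> G\<close> is attained, and the graphs \<open>K\<^bsub>1,n\<^esub>\<close> exist.\<close>

lemma cops_win_card:
  assumes "finite (pverts G)"
  shows "cops_win G (card (pverts G))"
proof -
  obtain c\<^sub>0 where c: "set c\<^sub>0 = pverts G" "length c\<^sub>0 = card (pverts G)"
    using assms finite_distinct_list distinct_card by metis
  have "cop_strategy G (card (pverts G)) c\<^sub>0 (\<lambda>h. fst (last h))"
    using c by (auto simp: cop_strategy_def cop_placement_def cop_move_def may_step_def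
        intro: list_all2_refl)
  then have "winning_cop_strategy G (card (pverts G)) c\<^sub>0 (\<lambda>h. fst (last h))"
    using c by (auto simp: winning_cop_strategy_def play_against_def)
  then show ?thesis unfolding cops_win_def by blast
qed

lemma surrounding_cop_number_attained:
  assumes "finite (pverts G)" "pverts G \<noteq> {}"
  shows "\<sigma> G \<ge> 1 \<and> cops_win G (\<sigma> G)"
  unfolding surrounding_cop_number_def
  by (rule LeastI[where k = "card (pverts G)"])
    (use assms cops_win_card in \<open>auto simp: Suc_le_eq card_gt_0_iff\<close>)

lemma pair_graph_strong_product:
  assumes "pair_graph G" "pair_graph H"
  shows "pair_graph (G \<boxtimes> H)"
proof -
  interpret G: pair_graph G by fact
  interpret H: pair_graph H by fact
  have fin: "finite (pverts (G \<boxtimes> H))"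
    by (simp add: strong_product_def G.pair_finite_verts H.pair_finite_verts)
  have sub: "parcs (G \<boxtimes> H) \<subseteq> pverts (G \<boxtimes> H) \<times> pverts (G \<boxtimes> H)"
    by (auto simp: strong_product_def)
  have "sym (parcs G)" "sym (parcs H)"
    using G.sym_arcs H.sym_arcs by (simp_all add: symmetric_def)
  then have sym: "sym (parcs (G \<boxtimes> H))"
    by (auto simp: strong_product_def sym_def)
  show ?thesis
    using fin sub sym finite_subset[OF sub]
    by unfold_locales (auto simp: symmetric_def strong_product_def)
qed

lemma star_exists:
  "K\<^bsub>1,n\<^esub> (with_proj \<lparr> pverts = {0..n}, parcs = {0} \<times> {1..n} \<union> {1..n} \<times> {0} \<rparr>)"
  unfolding complete_bipartite_digraph_pair_def
  by (intro conjI exI[where x = "{0}"] exI[where x = "{1..n}"]) auto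

end

theory Submission
  imports Defs
begin

text \<open>
  The robber confines himself to the vertices with at least one coordinate at a centre. Each of
  them has more than \<open>n\<close> neighbours of the same kind, so \<open>n\<close> cops can neither surround him there
  nor keep him from moving on to another such vertex.
\<close>

lemma list_misses_large_set:
  assumes "length c < card A"
  obtains x where "x \<in> A" "x \<notin> set c"
  by (metis assms card_length card_mono leD le_trans List.finite_set subsetI)

lemma cop_move_placement:
  assumes "parcs G \<subseteq> pverts G \<times> pverts G" "cop_placement G k c" "cop_move G c c'"
  shows "cop_placement G k c'"
  using assms
  by (fastforce simp: cop_placement_def cop_move_def may_step_def list_all2_conv_all_nth
      in_set_conv_nth subset_iff)

text \<open>Since \<open>k\<close> cops occupy at most \<open>k\<close> vertices, a robber in
  \<open>S\<close> always sees a free neighbour in \<open>S\<close>. It serves both as his next move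
  and as a witness that he is not surrounded.\<close>

lemma not_cops_win_if_dense_subset:
  assumes wf: "parcs G \<subseteq> pverts G \<times> pverts G" and S: "S \<subseteq> pverts G" "S \<noteq> {}"
    and deg: "\<And>v. v \<in> S \<Longrightarrow> k < card {w \<in> S. (v, w) \<in> parcs G}"
  shows "\<not> cops_win G k"
proof
  assume "cops_win G k"
  then obtain c\<^sub>0 f where strat: "cop_strategy G k c\<^sub>0 f"
    and win: "\<And>c r. play_against G c\<^sub>0 f c r \<Longrightarrow>
        \<exists>t. surrounded G (c t) (r t) \<or> surrounded G (c (Suc t)) (r t)"
    unfolding cops_win_def winning_cop_strategy_def by blast
  have escape: "\<exists>w. w \<in> S \<and> (v, w) \<in> parcs G \<and> w \<notin> set c"
    if "v \<in> S" "cop_placement G k c" for v c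
  proof -
    have "length c < card {w \<in> S. (v, w) \<in> parcs G}"
      using deg that by (simp add: cop_placement_def)
    from list_misses_large_set[OF this] show ?thesis by blast
  qed
  define esc where "esc c v = (SOME w. w \<in> S \<and> (v, w) \<in> parcs G \<and> w \<notin> set c)" for c v
  have esc: "esc c v \<in> S" "(v, esc c v) \<in> parcs G" "esc c v \<notin> set c"
    if "v \<in> S" "cop_placement G k c" for v c
    using someI_ex[OF escape[OF that]] by (simp_all add: esc_def)
  have c\<^sub>0: "cop_placement G k c\<^sub>0" using strat by (simp add: cop_strategy_def)
  \<comment> \<open>A free starting vertex comes from \<open>escape\<close> applied to an arbitrary
    vertex of \<open>S\<close>.\<close>
  obtain r\<^sub>0 where r\<^sub>0: "r\<^sub>0 \<in> S" "r\<^sub>0 \<notin> set c\<^sub>0" using S escape c\<^sub>0 by blast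
  \<comment> \<open>The strategy \<open>f\<close> may depend on the whole history, so the recursion
    builds the history itself; \<open>c\<close> and \<open>r\<close> are read off its last
    entry.\<close>
  define hist where "hist = rec_nat [(c\<^sub>0, r\<^sub>0)] (\<lambda>_ h. h @ [(f h, esc (f h) (snd (last h)))])"
  have hist_0: "hist 0 = [(c\<^sub>0, r\<^sub>0)]"
    and hist_Suc: "hist (Suc t) = hist t @ [(f (hist t), esc (f (hist t)) (snd (last (hist t))))]"
    for t by (simp_all add: hist_def)
  define c where "c t = fst (last (hist t))" for t
  define r where "r t = snd (last (hist t))" for t
  have hist: "hist t = map (\<lambda>i. (c i, r i)) [0..<Suc t]" for t
    by (induction t) (simp_all add: hist_0 hist_Suc c_def r_def)
  have c_Suc: "c (Suc t) = f (hist t)" and r_Suc: "r (Suc t) = esc (c (Suc t)) (r t)" for t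
    by (simp_all add: c_def r_def hist_Suc)
  \<comment> \<open>\<open>f\<close> is known to move legally only from a placement of
    \<open>k\<close> cops with the robber on a vertex, so both facts are carried along in one
    invariant.\<close>
  have step: "cop_placement G k (c (Suc t))" if "cop_placement G k (c t)" "r t \<in> S" for t
  proof -
    have "f (hist t) = f (map (\<lambda>i. (c i, r i)) [0..<t] @ [(c t, r t)])" by (simp add: hist)
    then have "cop_move G (c t) (c (Suc t))"
      using strat that S by (auto simp: cop_strategy_def c_Suc)
    with wf that show ?thesis by (blast intro: cop_move_placement)
  qed
  have inv: "cop_placement G k (c t) \<and> r t \<in> S" for t
  proof (induction t)
    case 0
    show ?case using c\<^sub>0 r\<^sub>0 by (simp add: c_def r_def hist_0)
  next
    case (Suc t)
    then show ?case using step esc by (simp add: r_Suc)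
  qed
  have "c (Suc t) = f (map (\<lambda>i. (c i, r i)) [0..<Suc t])" for t
    by (simp only: c_Suc hist)
  moreover have "robber_move G (c (Suc t)) (r t) (r (Suc t))" for t
    using esc[of "r t" "c (Suc t)"] inv by (simp add: robber_move_def may_step_def r_Suc)
  moreover have "c 0 = c\<^sub>0" "r 0 = r\<^sub>0" by (simp_all add: c_def r_def hist_0)
  ultimately have "play_against G c\<^sub>0 f c r"
    unfolding play_against_def using S r\<^sub>0 by blast
  then obtain t where "surrounded G (c t) (r t) \<or> surrounded G (c (Suc t)) (r t)"
    using win by blast
  \<comment> \<open>The invariant at \<open>t\<close> and at \<open>Suc t\<close> makes both
    \<open>c t\<close> and \<open>c (Suc t)\<close> placements of \<open>k\<close> cops, so
    \<open>escape\<close> refutes either way of being surrounded at \<open>r t\<close>.\<close>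
  then show False using escape inv by (meson surrounded_def)
qed

lemma complete_bipartite_1_n_star:
  assumes "K\<^bsub>1,n\<^esub> (with_proj G)"
  obtains x L where "pverts G = insert x L" "x \<notin> L" "finite L" "card L = n"
    "parcs G = {x} \<times> L \<union> L \<times> {x}"
  using assms unfolding complete_bipartite_digraph_pair_def
  by (auto simp: card_1_singleton_iff)

theorem theorem20:
  fixes n :: nat
    and G :: "'a pair_pre_digraph"
    and H :: "'b pair_pre_digraph"
  assumes "n \<ge> 1"
    and "K\<^bsub>1,n\<^esub> (with_proj G)"
    and "K\<^bsub>1,n\<^esub> (with_proj H)"
  shows "\<sigma> (G \<boxtimes> H) \<ge> n + 1"
proof -
  obtain x L where G: "pverts G = insert x L" "x \<notin> L" "finite L" "card L = n"
    "parcs G = {x} \<times> L \<union> L \<times> {x}"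
    using assms(2) by (rule complete_bipartite_1_n_star)
  obtain y M where H: "pverts H = insert y M" "y \<notin> M" "finite M" "card M = n"
    "parcs H = {y} \<times> M \<union> M \<times> {y}"
    using assms(3) by (rule complete_bipartite_1_n_star)
  define S where "S = {x} \<times> pverts H \<union> pverts G \<times> {y}"
  have deg: "n < card {w \<in> S. (v, w) \<in> parcs (G \<boxtimes> H)}" (is "n < card ?N") if v: "v \<in> S" for v
  proof -
    have fin: "finite ?N" by (rule finite_subset[of _ S]) (auto simp: S_def G H)
    obtain m where m: "m \<in> M" using H assms(1) by fastforce
    consider "v = (x, y)" | j where "v = (x, j)" "j \<in> M" | i where "v = (i, y)" "i \<in> L"
      using v by (auto simp: S_def G H)
    \<comment> \<open>It suffices to exhibit \<open>n + 1\<close> neighbours in \<open>S\<close>.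
      The double centre has the \<open>n\<close> vertices of \<open>L \<times> {y}\<close> and, as
      \<open>n \<ge> 1\<close>, also \<open>(x, m)\<close>. From \<open>(x, j)\<close> with
      \<open>j\<close> a leaf, every vertex of \<open>pverts G \<times> {y}\<close> is adjacent,
      because \<open>x\<close> equals or is adjacent to each vertex of \<open>G\<close>; the third
      case is symmetric.\<close>
    then obtain B where B: "B \<subseteq> ?N" "card B = n + 1"
    proof cases
      case 1
      show thesis
      proof
        show "insert (x, m) (L \<times> {y}) \<subseteq> ?N"
          using 1 m G H by (auto simp: S_def strong_product_def)
      qed (use G H m in \<open>auto simp: card_cartesian_product card_insert_if\<close>)
    next
      case 2
      show thesis
      proof
        show "insert x L \<times> {y} \<subseteq> ?N"
          using 2 G H by (auto simp: S_def strong_product_def)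
      qed (use G H in \<open>auto simp: card_cartesian_product\<close>)
    next
      case 3
      show thesis
      proof
        show "{x} \<times> insert y M \<subseteq> ?N"
          using 3 G H by (auto simp: S_def strong_product_def)
      qed (use G H in \<open>auto simp: card_cartesian_product\<close>)
    qed
    show ?thesis using card_mono[OF fin B(1)] B(2) by simp
  qed
  \<comment> \<open>Treating all \<open>k \<le> n\<close> at once avoids showing that
    \<open>cops_win\<close> is monotone in \<open>k\<close>.\<close>
  have "\<not> cops_win (G \<boxtimes> H) k" if "k \<le> n" for k
  proof (rule not_cops_win_if_dense_subset[where S = S])
    show "k < card {w \<in> S. (v, w) \<in> parcs (G \<boxtimes> H)}" if "v \<in> S" for v
      using deg[OF that] \<open>k \<le> n\<close> by simp
  qed (use G H in \<open>auto simp: S_def strong_product_def\<close>)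
  moreover have "cops_win (G \<boxtimes> H) (\<sigma> (G \<boxtimes> H))"
    using surrounding_cop_number_attained[of "G \<boxtimes> H"] G H by (simp add: strong_product_def)
  ultimately show ?thesis by (metis Suc_eq_plus1 not_less_eq_eq)
qed

end
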